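(* Let $\mathcal{P}=(V,P)$ be a finite poset and let $\chi(G_\mathcal{P})$ be the chromatic number of its underlying comparability graph $G_\mathcal{P}$, with $\chi(G_\mathcal{P})>1$. Then $\dim(\mathcal{P})\ge \dfrac{\mathrm{box}(G_\mathcal{P})}{\chi(G_\mathcal{P})-1}$.
   Context: The boxicity $\mathrm{box}(G)$ of a finite simple graph $G$ is the minimum integer $k$ such that vertices can be mapped to axis-parallel boxes in $\mathbb{R}^k$ (products of $k$ closed intervals) with two vertices adjacent iff their boxes intersect; a complete graph has boxicity $0$. The dimension $\dim(\mathcal{P})$ of a poset is the minimum number of linear extensions of $P$ whose intersection is $P$ (i.e. for distinct $x,y$: $x<y$ in $P$ iff $x<y$ in all of them). The underlying comparability graph $G_\mathcal{P}$ has vertex set $V$ and two distinct vertices are adjacent iff they are comparable in $P$. *)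

theory Defs
  imports Complex_Main "HOL-Library.FuncSet" "Graph_Theory.Pair_Digraph"
begin

text \<open>
  A finite simple graph is a \<^locale>\<open>pair_graph\<close>: a finite vertex set with a symmetric and
  irreflexive set of arcs, so that each undirected edge is present as a pair of opposite arcs.
\<close>

definition proper_colouring :: "'a pair_pre_digraph \<Rightarrow> nat \<Rightarrow> ('a \<Rightarrow> nat) \<Rightarrow> bool" where
  "proper_colouring G k c \<longleftrightarrow>
     (\<forall>v\<in>pverts G. c v < k) \<and> (\<forall>(u, v)\<in>parcs G. c u \<noteq> c v)"

definition chromatic_number :: "'a pair_pre_digraph \<Rightarrow> nat" where
  "chromatic_number G = (LEAST k. \<exists>c. proper_colouring G k c)"

text \<open>
  Points of \<open>\<real>\<^sup>k\<close> are the extensional functions on \<open>{..<k}\<close>, since the dimension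
  \<open>k\<close> is minimised over below.  \<open>\<real>\<^sup>0\<close> is a single point, which is then the only box, so
  that exactly the complete graphs have a representation in dimension 0.
\<close>

definition axis_parallel_box :: "nat \<Rightarrow> (nat \<Rightarrow> real) set \<Rightarrow> bool" where
  "axis_parallel_box k B \<longleftrightarrow>
     (\<exists>l r. (\<forall>i<k. l i \<le> r i) \<and> B = (\<Pi>\<^sub>E i\<in>{..<k}. {l i..r i}))"

definition box_representation ::
    "'a pair_pre_digraph \<Rightarrow> nat \<Rightarrow> ('a \<Rightarrow> (nat \<Rightarrow> real) set) \<Rightarrow> bool" where
  "box_representation G k f \<longleftrightarrow>
     (\<forall>v\<in>pverts G. axis_parallel_box k (f v)) \<and>
     (\<forall>u\<in>pverts G. \<forall>v\<in>pverts G. u \<noteq> v \<longrightarrow> ((u, v) \<in> parcs G \<longleftrightarrow> f u \<inter> f v \<noteq> {}))"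

definition boxicity :: "'a pair_pre_digraph \<Rightarrow> nat" where
  "boxicity G = (LEAST k. \<exists>f. box_representation G k f)"

definition linear_extension :: "'a set \<Rightarrow> 'a rel \<Rightarrow> 'a rel \<Rightarrow> bool" where
  "linear_extension V P L \<longleftrightarrow> linear_order_on V L \<and> P \<subseteq> L"

definition realizer :: "'a set \<Rightarrow> 'a rel \<Rightarrow> 'a rel set \<Rightarrow> bool" where
  "realizer V P R \<longleftrightarrow>
     (\<forall>L\<in>R. linear_extension V P L) \<and>
     (\<forall>x\<in>V. \<forall>y\<in>V. x \<noteq> y \<longrightarrow> ((x, y) \<in> P \<longleftrightarrow> (\<forall>L\<in>R. (x, y) \<in> L)))"

definition poset_dim :: "'a set \<Rightarrow> 'a rel \<Rightarrow> nat" where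
  "poset_dim V P = (LEAST k. \<exists>R. finite R \<and> card R = k \<and> realizer V P R)"

definition comparability_graph :: "'a set \<Rightarrow> 'a rel \<Rightarrow> 'a pair_pre_digraph" where
  "comparability_graph V P =
     \<lparr>pverts = V,
      parcs = {(x, y). x \<in> V \<and> y \<in> V \<and> x \<noteq> y \<and> ((x, y) \<in> P \<or> (y, x) \<in> P)}\<rparr>"

lemma pair_graph_comparability_graph:
  assumes "finite V"
  shows "pair_graph (comparability_graph V P)"
proof -
  have "finite (parcs (comparability_graph V P))"
    by (rule finite_subset[of _ "V \<times> V"]) (auto simp: comparability_graph_def assms)
  then show ?thesis
    by unfold_locales
      (auto simp: comparability_graph_def assms symmetric_def intro!: symI)
qed

end

theory Submission
  imports Defs
begin

text \<open>
  Write \<open>k\<close> for the chromatic number. Chains are cliques, so ranking elements by the longest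
  chain below them gives a strictly monotone \<open>h\<close> with values below \<open>k\<close>. A linear extension
  \<open>L\<close> with position function \<open>p\<close> and a level \<open>i\<close> give an interval supergraph of the
  comparability graph: \<open>x\<close> is sent to \<open>[p x, p x]\<close>, \<open>[0, p x]\<close> or \<open>[p x, |V|]\<close> according
  to whether \<open>h x = i\<close>, \<open>h x > i\<close> or \<open>h x < i\<close>. It separates two elements of level \<open>i\<close>, and
  it separates \<open>x\<close> from \<open>y\<close> if \<open>h x \<le> i \<le> h y\<close>, \<open>h x < h y\<close> and \<open>y\<close> precedes \<open>x\<close> in \<open>L\<close>.
  For the second kind of pair, \<open>L\<close> may skip level \<open>0\<close> or level \<open>k - 1\<close>. Unless the order
  is total, a realizer has two members; letting one skip level \<open>k - 1\<close> and all others level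
  \<open>0\<close> still covers every level, with \<open>k - 1\<close> intervals per extension.
\<close>

section \<open>Boxes from families of intervals\<close>

text \<open>Boxes meet iff they meet in every coordinate, so intersecting interval graphs over
  \<open>I\<close> gives boxes once \<open>I\<close> is enumerated. An arbitrary index type allows
  pairs of a linear extension and a level later.\<close>

lemma boxicity_le_card:
  fixes l r :: "'a \<Rightarrow> 'i \<Rightarrow> real"
  assumes "finite I"
    and le: "\<And>v i. v \<in> pverts G \<Longrightarrow> i \<in> I \<Longrightarrow> l v i \<le> r v i"
    and adj: "\<And>u v. u \<in> pverts G \<Longrightarrow> v \<in> pverts G \<Longrightarrow> u \<noteq> v \<Longrightarrow>
      (u, v) \<in> parcs G \<longleftrightarrow> (\<forall>i\<in>I. l u i \<le> r v i \<and> l v i \<le> r u i)"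
  shows "boxicity G \<le> card I"
proof -
  obtain e where e: "bij_betw e {..<card I} I"
    using ex_bij_betw_nat_finite[OF \<open>finite I\<close>] by (auto simp: atLeast0LessThan)
  have eI: "e i \<in> I" if "i < card I" for i
    using bij_betwE[OF e] that by simp
  define f where "f v = (\<Pi>\<^sub>E i\<in>{..<card I}. {l v (e i)..r v (e i)})" for v
  have "box_representation G (card I) f"
    unfolding box_representation_def
  proof (intro conjI ballI impI)
    fix v assume "v \<in> pverts G"
    then show "axis_parallel_box (card I) (f v)"
      unfolding axis_parallel_box_def f_def using le eI
      by (intro exI[of _ "\<lambda>i. l v (e i)"] exI[of _ "\<lambda>i. r v (e i)"]) auto
  next
    fix u v assume uv: "u \<in> pverts G" "v \<in> pverts G" "u \<noteq> v"
    have "f u \<inter> f v \<noteq> {} \<longleftrightarrow>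
        (\<forall>j\<in>{..<card I}. {l u (e j)..r u (e j)} \<inter> {l v (e j)..r v (e j)} \<noteq> {})"
      unfolding f_def PiE_Int by (simp add: PiE_eq_empty_iff)
    also have "\<dots> \<longleftrightarrow> (\<forall>j\<in>{..<card I}. l u (e j) \<le> r v (e j) \<and> l v (e j) \<le> r u (e j))"
    proof (rule ball_cong)
      fix j assume "j \<in> {..<card I}"
      then have "l u (e j) \<le> r u (e j)" "l v (e j) \<le> r v (e j)"
        using le uv eI by auto
      then show "{l u (e j)..r u (e j)} \<inter> {l v (e j)..r v (e j)} \<noteq> {} \<longleftrightarrow>
          l u (e j) \<le> r v (e j) \<and> l v (e j) \<le> r u (e j)"
        by auto
    qed simp
    also have "\<dots> \<longleftrightarrow> (\<forall>i\<in>I. l u i \<le> r v i \<and> l v i \<le> r u i)"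
      using bij_betw_imp_surj_on[OF e] by (metis (no_types, lifting) image_iff)
    finally show "(u, v) \<in> parcs G \<longleftrightarrow> f u \<inter> f v \<noteq> {}"
      using adj[OF uv] by simp
  qed
  then show ?thesis
    unfolding boxicity_def by (intro Least_le) blast
qed

section \<open>Linear extensions and minimum realizers\<close>

text \<open>The union is the transitive closure of \<open>P\<close> with \<open>(x, y)\<close>
  added. A failure of antisymmetry would use a new pair and force
  \<open>(y, x) \<in> P\<close>.\<close>

lemma partial_order_on_insert_pair:
  assumes P: "partial_order_on V P" and "x \<in> V" "y \<in> V" and "(y, x) \<notin> P"
  shows "partial_order_on V (P \<union> {(a, b). (a, x) \<in> P \<and> (y, b) \<in> P})"
  using assms unfolding partial_order_on_def preorder_on_def
  apply (intro conjI)
  subgoal by blast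
  subgoal by (simp add: refl_on_def)
  subgoal unfolding trans_def by blast
  subgoal unfolding antisym_def trans_def by blast
  done

text \<open>Szpilrajn's theorem in the finite case: a maximal partial order above \<open>P\<close>
  is total, since otherwise an incomparable pair could still be added.\<close>

lemma linear_extension_exists:
  assumes "finite V" and P: "partial_order_on V P"
  obtains L where "linear_extension V P L"
proof -
  let ?E = "{Q. partial_order_on V Q \<and> P \<subseteq> Q}"
  have "?E \<subseteq> Pow (V \<times> V)"
    by (auto simp: partial_order_on_def preorder_on_def)
  then have "finite ?E"
    by (rule finite_subset) (simp add: \<open>finite V\<close>)
  moreover have "?E \<noteq> {}"
    using P by blast
  ultimately obtain L where L: "L \<in> ?E" and max: "\<And>Q. Q \<in> ?E \<Longrightarrow> L \<subseteq> Q \<Longrightarrow> L = Q"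
    using finite_has_maximal[of ?E] by auto
  have "total_on V L"
    unfolding total_on_def
  proof (intro ballI impI, rule ccontr)
    fix x y assume xy: "x \<in> V" "y \<in> V" "x \<noteq> y" "\<not> ((x, y) \<in> L \<or> (y, x) \<in> L)"
    let ?Q = "L \<union> {(a, b). (a, x) \<in> L \<and> (y, b) \<in> L}"
    have "partial_order_on V ?Q"
      using partial_order_on_insert_pair[of V L x y] L xy by simp
    then have "L = ?Q"
      using L by (intro max) auto
    moreover have "(x, x) \<in> L" "(y, y) \<in> L"
      using L xy by (auto simp: partial_order_on_def preorder_on_def refl_on_def)
    ultimately show False
      using xy by blast
  qed
  then have "linear_extension V P L"
    using L by (simp add: linear_extension_def linear_order_on_def)
  then show ?thesis ..
qed

text \<open>The minimum defining \<open>poset_dim\<close> is attained because the set of all linear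
  extensions is a finite realizer.\<close>

lemma minimum_realizer_exists:
  assumes "finite V" and P: "partial_order_on V P"
  obtains R where "finite R" "card R = poset_dim V P" "realizer V P R"
proof -
  let ?R = "{L. linear_extension V P L}"
  have "?R \<subseteq> Pow (V \<times> V)"
    by (auto simp: linear_extension_def linear_order_on_def partial_order_on_def preorder_on_def)
  then have fin: "finite ?R"
    by (rule finite_subset) (simp add: \<open>finite V\<close>)
  have "\<exists>L. linear_extension V P L \<and> (x, y) \<notin> L"
    if xy: "x \<in> V" "y \<in> V" "x \<noteq> y" "(x, y) \<notin> P" for x y
  proof -
    \<comment> \<open>Forcing \<open>y\<close> below \<open>x\<close> makes every linear extension
      of \<open>?Q\<close> omit \<open>(x, y)\<close>.\<close>
    let ?Q = "P \<union> {(a, b). (a, y) \<in> P \<and> (x, b) \<in> P}"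
    have "partial_order_on V ?Q"
      using partial_order_on_insert_pair[OF P] xy by blast
    then obtain L where L: "linear_extension V ?Q L"
      using linear_extension_exists[OF \<open>finite V\<close>] by blast
    have "(x, x) \<in> P" "(y, y) \<in> P"
      using P xy by (auto simp: partial_order_on_def preorder_on_def refl_on_def)
    with L have "(y, x) \<in> L" "antisym L"
      by (auto simp: linear_extension_def linear_order_on_def partial_order_on_def)
    with \<open>x \<noteq> y\<close> have "(x, y) \<notin> L"
      by (auto dest: antisymD)
    moreover have "linear_extension V P L"
      using L by (auto simp: linear_extension_def)
    ultimately show ?thesis by blast
  qed
  then have "realizer V P ?R"
    unfolding realizer_def by (auto simp: linear_extension_def)
  with fin have "\<exists>k R. finite R \<and> card R = k \<and> realizer V P R"
    by blast
  then have "\<exists>R. finite R \<and> card R = poset_dim V P \<and> realizer V P R"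
    unfolding poset_dim_def by (rule LeastI_ex)
  then show ?thesis using that by blast
qed

section \<open>Colourings and ranks\<close>

lemma chromatic_number_colouring:
  assumes "pair_graph G"
  obtains c where "proper_colouring G (chromatic_number G) c"
proof -
  interpret pair_graph G by fact
  obtain c :: "'a \<Rightarrow> nat" and n where "c ` pverts G = {i. i < n}" "inj_on c (pverts G)"
    using finite_imp_inj_to_nat_seg[OF pair_finite_verts] by blast
  moreover have "u \<in> pverts G \<and> v \<in> pverts G \<and> u \<noteq> v" if "(u, v) \<in> parcs G" for u v
    using that in_arcsD1 in_arcsD2 no_loops' by blast
  ultimately have "proper_colouring G n c"
    unfolding proper_colouring_def by (fastforce simp: inj_on_def)
  then have "\<exists>k c. proper_colouring G k c"
    by blast
  then have "\<exists>c. proper_colouring G (chromatic_number G) c"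
    unfolding chromatic_number_def by (rule LeastI_ex)
  then show ?thesis using that by blast
qed

text \<open>An element together with a chain below it is a clique, so a proper colouring is
  injective on it and bounds its size by \<open>k\<close>.\<close>

lemma rank_function_exists:
  assumes "finite V" and P: "partial_order_on V P"
    and c: "proper_colouring (comparability_graph V P) k c"
  obtains h :: "'a \<Rightarrow> nat" where "\<And>x. x \<in> V \<Longrightarrow> h x < k"
    and "\<And>x y. (x, y) \<in> P \<Longrightarrow> x \<noteq> y \<Longrightarrow> h x < h y"
proof -
  \<comment> \<open>The chains strictly below \<open>x\<close>; leaving out \<open>x\<close> itself
    makes ranks start at 0.\<close>
  define B where "B x = {C. C \<subseteq> {z. (z, x) \<in> P \<and> z \<noteq> x} \<and>
    (\<forall>u\<in>C. \<forall>v\<in>C. (u, v) \<in> P \<or> (v, u) \<in> P)}" for x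
  have PV: "P \<subseteq> V \<times> V" and "trans P" and "antisym P"
    using P by (auto simp: partial_order_on_def preorder_on_def)
  have "B x \<subseteq> Pow V" for x
    using PV by (auto simp: B_def)
  then have finB: "finite (B x)" for x
    using \<open>finite V\<close> by (meson finite_Pow_iff finite_subset)
  have neB: "{} \<in> B x" for x
    by (simp add: B_def)
  define h where "h x = Max (card ` B x)" for x
  have extend: "insert x C \<in> B y" and card: "card (insert x C) = Suc (card C)"
    if "(x, y) \<in> P" "x \<noteq> y" "C \<in> B x" for x y C
  proof -
    have "refl_on V P"
      using P by (simp add: partial_order_on_def preorder_on_def)
    then have "(x, x) \<in> P"
      using PV that by (auto simp: refl_on_def)
    moreover have "(z, y) \<in> P \<and> z \<noteq> y" if "z \<in> C" for z
    proof -
      have "(z, x) \<in> P" "z \<noteq> x"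
        using \<open>C \<in> B x\<close> that by (auto simp: B_def)
      then show ?thesis
        using \<open>(x, y) \<in> P\<close> transD[OF \<open>trans P\<close>] antisymD[OF \<open>antisym P\<close>] by blast
    qed
    ultimately show "insert x C \<in> B y"
      using that by (auto simp: B_def)
    have "C \<subseteq> V" "x \<notin> C"
      using \<open>C \<in> B x\<close> PV by (auto simp: B_def)
    then show "card (insert x C) = Suc (card C)"
      using finite_subset[OF _ \<open>finite V\<close>] by simp
  qed
  have attained: "\<exists>C\<in>B x. h x = card C" for x
    unfolding h_def using Max_in[of "card ` B x"] finB neB by blast
  show ?thesis
  proof
    fix x y assume xy: "(x, y) \<in> P" "x \<noteq> y"
    obtain C where C: "C \<in> B x" "h x = card C"
      using attained by blast
    have "card (insert x C) \<le> h y"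
      unfolding h_def using extend[OF xy C(1)] finB by (intro Max_ge) auto
    then show "h x < h y"
      using card[OF xy C(1)] C(2) by simp
  next
    fix x assume "x \<in> V"
    obtain C where C: "C \<in> B x" "h x = card C"
      using attained by blast
    let ?D = "insert x C"
    have "?D \<subseteq> V" "x \<notin> C"
      using C PV \<open>x \<in> V\<close> by (auto simp: B_def)
    have "inj_on c ?D" and "c ` ?D \<subseteq> {..<k}"
    proof -
      show "c ` ?D \<subseteq> {..<k}"
        using \<open>?D \<subseteq> V\<close> c by (auto simp: proper_colouring_def comparability_graph_def)
      have "c u \<noteq> c v" if "u \<in> ?D" "v \<in> ?D" "u \<noteq> v" for u v
      proof -
        have "(u, v) \<in> P \<or> (v, u) \<in> P"
          using that C(1) by (auto simp: B_def)
        then show ?thesis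
          using c that \<open>?D \<subseteq> V\<close> by (auto simp: proper_colouring_def comparability_graph_def)
      qed
      then show "inj_on c ?D"
        by (auto simp: inj_on_def)
    qed
    then have "card ?D \<le> k"
      using card_inj_on_le[of c ?D "{..<k}"] by simp
    moreover have "card ?D = Suc (card C)"
      using \<open>?D \<subseteq> V\<close> \<open>x \<notin> C\<close> finite_subset[OF _ \<open>finite V\<close>, of C] by simp
    ultimately show "h x < k"
      using C(2) by simp
  qed
qed

section \<open>Intervals from linear extensions and levels\<close>

lemma linear_order_position_less_iff:
  assumes "finite V" and L: "linear_order_on V L" and "x \<in> V" "y \<in> V"
  shows "card {z. (z, x) \<in> L} < card {z. (z, y) \<in> L} \<longleftrightarrow> (x, y) \<in> L \<and> x \<noteq> y"
proof -
  have LV: "L \<subseteq> V \<times> V" and "refl_on V L" "trans L" "antisym L" "total_on V L"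
    using L by (auto simp: linear_order_on_def partial_order_on_def preorder_on_def)
  have less: "card {z. (z, u) \<in> L} < card {z. (z, v) \<in> L}" if "(u, v) \<in> L" "u \<noteq> v" for u v
  proof (rule psubset_card_mono)
    show "finite {z. (z, v) \<in> L}"
      using LV \<open>finite V\<close> by (auto intro: finite_subset[of _ V])
    have "(v, v) \<in> L"
      using LV \<open>refl_on V L\<close> that by (auto simp: refl_on_def)
    moreover have "(v, u) \<notin> L"
      using that \<open>antisym L\<close> by (auto dest: antisymD)
    ultimately show "{z. (z, u) \<in> L} \<subset> {z. (z, v) \<in> L}"
      using that transD[OF \<open>trans L\<close>] by blast
  qed
  show ?thesis
  proof (cases "x = y")
    case False
    then have "(x, y) \<in> L \<or> (y, x) \<in> L"
      using \<open>total_on V L\<close> assms by (auto simp: total_on_def)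
    with False show ?thesis
      using less[of x y] less[of y x] \<open>antisym L\<close> by (auto dest: antisymD)
  qed simp
qed

lemma boxicity_comparability_graph_le:
  fixes h :: "'a \<Rightarrow> nat"
  assumes "finite V" and P: "partial_order_on V P"
    and R: "finite R" "realizer V P R"
    and h: "\<And>x. x \<in> V \<Longrightarrow> h x < k" "\<And>x y. (x, y) \<in> P \<Longrightarrow> x \<noteq> y \<Longrightarrow> h x < h y"
    and "1 < k"
  shows "boxicity (comparability_graph V P) \<le> card R * (k - 1)"
proof (cases "\<exists>a\<in>V. \<exists>b\<in>V. a \<noteq> b \<and> (a, b) \<notin> P \<and> (b, a) \<notin> P")
  case False
  \<comment> \<open>Without incomparable pairs the graph is complete, and the empty family of
    intervals represents it.\<close>
  then have "boxicity (comparability_graph V P) \<le> card ({} :: nat set)"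
    by (intro boxicity_le_card[where l = "\<lambda>_ _. 0" and r = "\<lambda>_ _. 0"])
      (auto simp: comparability_graph_def)
  then show ?thesis by simp
next
  case True
  then obtain a b where ab: "a \<in> V" "b \<in> V" "a \<noteq> b" "(a, b) \<notin> P" "(b, a) \<notin> P"
    by blast
  have lin: "linear_order_on V L" and ext: "P \<subseteq> L" if "L \<in> R" for L
    using R that by (auto simp: realizer_def linear_extension_def)
  have separate: "\<exists>L\<in>R. (x, y) \<notin> L" if "x \<in> V" "y \<in> V" "x \<noteq> y" "(x, y) \<notin> P" for x y
    using R that unfolding realizer_def by blast
  obtain L1 where L1: "L1 \<in> R" "(a, b) \<notin> L1"
    using separate ab by blast
  obtain L2 where L2: "L2 \<in> R" "(b, a) \<notin> L2"
    using separate ab by blast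
  have "L1 \<noteq> L2"
    using lin[OF L1(1)] L1 L2 ab by (auto simp: linear_order_on_def total_on_def)
  \<comment> \<open>Each extension gets \<open>k - 1\<close> levels. \<open>L1\<close> supplies
    level 0 and \<open>L2\<close> level \<open>k - 1\<close>, so no level is lost overall.\<close>
  define J where "J L = (if L = L1 then {0..<k - 1} else {1..<k})" for L
  define I where "I = (SIGMA L:R. J L)"
  define p where "p L x = card {z. (z, x) \<in> L}" for L :: "'a rel" and x
  \<comment> \<open>The values 0 and \<open>card V\<close> bound all positions and act as infinite
    ends.\<close>
  define l where "l x = (\<lambda>(L, i). real (if i < h x then 0 else p L x))" for x
  define r where "r x = (\<lambda>(L, i). real (if h x < i then card V else p L x))" for x
  have p_less: "p L x < p L y \<longleftrightarrow> (x, y) \<in> L \<and> x \<noteq> y" if "L \<in> R" "x \<in> V" "y \<in> V" for L x y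
    unfolding p_def using linear_order_position_less_iff[OF \<open>finite V\<close> lin] that by blast
  have p_le: "p L x \<le> card V" if "L \<in> R" for L x
    unfolding p_def using lin[OF that]
    by (intro card_mono \<open>finite V\<close>)
      (auto simp: linear_order_on_def partial_order_on_def preorder_on_def)
  have meet: "l x j \<le> r y j \<and> l y j \<le> r x j"
    if "(x, y) \<in> P" "x \<noteq> y" "x \<in> V" "y \<in> V" "j \<in> I" for x y j
  proof -
    obtain L i where j: "j = (L, i)" "L \<in> R"
      using \<open>j \<in> I\<close> by (auto simp: I_def)
    have "p L x < p L y"
      using p_less that j ext by blast
    moreover have "h x < h y"
      using h that by blast
    \<comment> \<open>\<open>l x j \<le> r y j\<close> follows from the positions. For the other
      inequality, \<open>l y j\<close> is 0 if \<open>i < h y\<close>, and otherwise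
      \<open>h x < i\<close>, so \<open>r x j\<close> is \<open>card V\<close>.\<close>
    ultimately show ?thesis
      using p_le[OF j(2)] by (auto simp: l_def r_def j)
  qed
  have apart: "\<exists>j\<in>I. \<not> (l x j \<le> r y j \<and> l y j \<le> r x j)"
    if xy: "x \<in> V" "y \<in> V" "x \<noteq> y" "(x, y) \<notin> P" "(y, x) \<notin> P" and "h x \<le> h y" for x y
  proof (cases "h x = h y")
    case True
    have "\<exists>L\<in>R. h x \<in> J L"
    proof (cases "h x < k - 1")
      case True
      then show ?thesis using L1 by (auto simp: J_def)
    next
      case False
      moreover have "h x < k"
        using h xy by auto
      ultimately show ?thesis using L2 \<open>L1 \<noteq> L2\<close> \<open>1 < k\<close>
        by (intro bexI[of _ L2]) (auto simp: J_def)
    qed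
    then obtain L where L: "L \<in> R" "h x \<in> J L"
      by blast
    \<comment> \<open>On their own level both elements are sent to points, and these are
      distinct.\<close>
    have "p L x < p L y \<or> p L y < p L x"
      using p_less[OF L(1)] lin[OF L(1)] xy by (auto simp: linear_order_on_def total_on_def)
    then show ?thesis
      using L True by (intro bexI[of _ "(L, h x)"]) (auto simp: l_def r_def I_def)
  next
    case False
    then have hxy: "h x < h y"
      using \<open>h x \<le> h y\<close> by simp
    obtain L where L: "L \<in> R" "(x, y) \<notin> L"
      using separate xy by blast
    then have less: "p L y < p L x"
      using p_less[OF L(1)] lin[OF L(1)] xy by (auto simp: linear_order_on_def total_on_def)
    \<comment> \<open>The range from \<open>h x\<close> to \<open>h y\<close> holds at least two
      levels, so one survives when an extreme level is skipped. There \<open>l x\<close> and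
      \<open>r y\<close> are the positions of \<open>x\<close> and \<open>y\<close>, which
      \<open>L\<close> reverses.\<close>
    have "\<exists>i\<in>J L. h x \<le> i \<and> i \<le> h y"
    proof (cases "L = L1")
      case True
      then show ?thesis
        using hxy h(1)[OF xy(2)] by (intro bexI[of _ "h x"]) (auto simp: J_def)
    next
      case False
      then show ?thesis
        using hxy h(1)[OF xy(2)] by (intro bexI[of _ "h y"]) (auto simp: J_def)
    qed
    then obtain i where "i \<in> J L" "h x \<le> i" "i \<le> h y"
      by blast
    then show ?thesis
      using less L by (intro bexI[of _ "(L, i)"]) (auto simp: l_def r_def I_def)
  qed
  have "boxicity (comparability_graph V P) \<le> card I"
  proof (rule boxicity_le_card[where l = l and r = r])
    show "finite I"
      using R by (auto simp: I_def J_def)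
  next
    fix v j assume "v \<in> pverts (comparability_graph V P)" "j \<in> I"
    then show "l v j \<le> r v j"
      using p_le by (auto simp: l_def r_def I_def)
  next
    fix x y
    assume "x \<in> pverts (comparability_graph V P)" "y \<in> pverts (comparability_graph V P)" "x \<noteq> y"
    then have xy: "x \<in> V" "y \<in> V" "x \<noteq> y"
      by (auto simp: comparability_graph_def)
    show "(x, y) \<in> parcs (comparability_graph V P) \<longleftrightarrow>
        (\<forall>j\<in>I. l x j \<le> r y j \<and> l y j \<le> r x j)"
      \<comment> \<open>The condition is symmetric in \<open>x\<close> and \<open>y\<close>, so
        \<open>apart\<close> applies to whichever order has nondecreasing rank.\<close>
      using meet[of x y] meet[of y x] apart[of x y] apart[of y x] xy
      by (cases "h x \<le> h y") (fastforce simp: comparability_graph_def)+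
  qed
  also have "card I = card R * (k - 1)"
  proof -
    have "card (J L) = k - 1" and "finite (J L)" for L
      by (auto simp: J_def)
    then show ?thesis
      using R by (simp add: I_def)
  qed
  finally show ?thesis .
qed

theorem theorem2:
  fixes V :: "'a set" and P :: "'a rel"
  assumes "finite V"
    and "partial_order_on V P"
    and "chromatic_number (comparability_graph V P) > 1"
  shows "real (poset_dim V P) \<ge>
    real (boxicity (comparability_graph V P)) /
      (real (chromatic_number (comparability_graph V P)) - 1)"
proof -
  let ?G = "comparability_graph V P"
  let ?k = "chromatic_number ?G"
  obtain c where c: "proper_colouring ?G ?k c"
    using chromatic_number_colouring[OF pair_graph_comparability_graph[OF assms(1)]] by blast
  obtain h :: "'a \<Rightarrow> nat" where h: "\<And>x. x \<in> V \<Longrightarrow> h x < ?k"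
      "\<And>x y. (x, y) \<in> P \<Longrightarrow> x \<noteq> y \<Longrightarrow> h x < h y"
    using rank_function_exists[OF assms(1,2) c] by blast
  obtain R where R: "finite R" "card R = poset_dim V P" "realizer V P R"
    using minimum_realizer_exists[OF assms(1,2)] by blast
  have "boxicity ?G \<le> poset_dim V P * (?k - 1)"
    using boxicity_comparability_graph_le[OF assms(1,2) R(1,3) h assms(3)] R(2) by simp
  then have "real (boxicity ?G) \<le> real (poset_dim V P * (?k - 1))"
    by (rule of_nat_mono)
  \<comment> \<open>As \<open>?k > 1\<close>, natural subtraction agrees with real subtraction, and
    the divisor is positive.\<close>
  also have "\<dots> = real (poset_dim V P) * (real ?k - 1)"
    using assms(3) by (simp add: of_nat_diff)
  finally show ?thesis
    using assms(3) by (simp add: divide_le_eq)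
qed

end
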